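(* Phragmén's ordered method satisfies the following. Consider an election and let $A$ be one of the candidates. Suppose that some votes are changed in favour of $A$, either by adding a new ballot containing only $A$, by adding $A$ to an existing ballot at an arbitrary place (if $A$ did not already exist on the ballot), or by moving $A$ to a higher position (if $A$ already existed on the ballot); in all cases without changing the other candidates and their order. Then the change cannot hurt $A$: if $A$ would have been elected before the change, then the same is true after the change.
   Context: There is a finite set of candidates and a finite collection of ballots; each ballot is an ordered list of distinct candidates (not necessarily all of them). A fixed number $s\ge1$ of candidates is to be elected, the same before and after the change. Phragmén's ordered method: every ballot $b$ has a place number $r_b$, initially $0$. Seats are filled one by one until $s$ candidates have been elected. For each seat, each ballot is counted only for its current top candidate, i.e. the first candidate on it that is not yet elected (ballots all of whose candidates are elected are ignored). For a not yet elected candidate $i$, let $B_i$ be the set of ballots currently counted for $i$; the reduced vote of $i$ is $W_i:=|B_i|/(1+\sum_{b\in B_i} r_b)$. The candidate $i$ with the largest $W_i$ is elected, and then $r_b$ is replaced by $1/W_i$ for all $b\in B_i$ (other place numbers are unchanged). Equivalently: each ballot has voting power $t$ increasing continuously from $0$; the part of the voting power of a ballot that is not already assigned to elected candidates is available to its current top candidate; as soon as a candidate has available total voting power $1$ it is elected and this voting power is permanently assigned to it. Ties are resolved by lot or by some other rule. If $A$ ties for the last place both for the original and for the changed ballots, it is assumed that the tie is resolved in the same way in both cases. *)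

theory Defs
  imports Complex_Main
begin

text \<open>
  \<open>C\<close> is the set of candidates. The ballots are a family \<open>b\<close> of lists indexed by a finite set
  \<open>V\<close>, so that equal ballots may occur and every single ballot carries its own place number.
\<close>

definition election :: "'c set \<Rightarrow> 'v set \<Rightarrow> ('v \<Rightarrow> 'c list) \<Rightarrow> bool" where
  "election C V b \<longleftrightarrow>
     finite C \<and> finite V \<and> (\<forall>v\<in>V. distinct (b v) \<and> set (b v) \<subseteq> C)"

text \<open>
  \<open>E\<close> is the set of candidates elected so far; \<open>find\<close> returns \<open>None\<close> on a ballot all of whose
  candidates are elected, so that such a ballot is counted for nobody.
\<close>

definition counted_for :: "'v set \<Rightarrow> ('v \<Rightarrow> 'c list) \<Rightarrow> 'c set \<Rightarrow> 'c \<Rightarrow> 'v set" where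
  "counted_for V b E i = {v \<in> V. find (\<lambda>j. j \<notin> E) (b v) = Some i}"

definition reduced_vote ::
    "'v set \<Rightarrow> ('v \<Rightarrow> 'c list) \<Rightarrow> 'c set \<Rightarrow> ('v \<Rightarrow> real) \<Rightarrow> 'c \<Rightarrow> real" where
  "reduced_vote V b E r i =
     real (card (counted_for V b E i)) / (1 + (\<Sum>v\<in>counted_for V b E i. r v))"

text \<open>
  A course of the count is recorded as the list \<open>e\<close> of the elected candidates in order of
  election. \<open>place_number V b e k v\<close> is the place number of ballot \<open>v\<close> after \<open>e ! 0\<close>, \dots,
  \<open>e ! (k - 1)\<close> have been elected. If \<open>e ! k\<close> has reduced vote \<open>0\<close>, then no ballot is counted
  for it, and the division by zero does not arise.
\<close>

primrec place_number ::
    "'v set \<Rightarrow> ('v \<Rightarrow> 'c list) \<Rightarrow> 'c list \<Rightarrow> nat \<Rightarrow> 'v \<Rightarrow> real" where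
  "place_number V b e 0 = (\<lambda>v. 0)"
| "place_number V b e (Suc k) =
     (\<lambda>v. if v \<in> counted_for V b (set (take k e)) (e ! k)
          then 1 / reduced_vote V b (set (take k e)) (place_number V b e k) (e ! k)
          else place_number V b e k v)"

definition vote_at :: "'v set \<Rightarrow> ('v \<Rightarrow> 'c list) \<Rightarrow> 'c list \<Rightarrow> nat \<Rightarrow> 'c \<Rightarrow> real" where
  "vote_at V b e k i = reduced_vote V b (set (take k e)) (place_number V b e k) i"

text \<open>
  A possible result of the ordered method for \<open>s\<close> seats. At each seat any candidate with the
  largest reduced vote may be chosen, so that ties are resolved in an arbitrary way.
\<close>

definition phragmen_result ::
    "'c set \<Rightarrow> 'v set \<Rightarrow> ('v \<Rightarrow> 'c list) \<Rightarrow> nat \<Rightarrow> 'c list \<Rightarrow> bool" where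
  "phragmen_result C V b s e \<longleftrightarrow>
     length e = s \<and>
     (\<forall>k<s. e ! k \<in> C - set (take k e) \<and>
            (\<forall>j\<in>C - set (take k e). vote_at V b e k j \<le> vote_at V b e k (e ! k)))"

text \<open>
  \<open>A\<close> ties for the last place in the count \<open>e\<close>: some candidate left without a seat has, at the
  last seat, the same reduced vote \<open>w\<close> as the candidate elected there, and \<open>A\<close> takes part in
  this tie, either as a loser or as a winner. If several of the tied candidates get a seat
  (for example, three candidates tie for the last two seats), then the winner \<open>A\<close> may have been
  chosen at an earlier seat than the last one, but with the same reduced vote \<open>w\<close>; this is why all
  seats \<open>k\<close> are considered.
\<close>

definition ties_for_last_place ::
    "'c set \<Rightarrow> 'v set \<Rightarrow> ('v \<Rightarrow> 'c list) \<Rightarrow> 'c list \<Rightarrow> 'c \<Rightarrow> bool" where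
  "ties_for_last_place C V b e A \<longleftrightarrow>
     (let m = length e - 1; w = vote_at V b e m (e ! m) in
        (\<exists>j\<in>C - set e. vote_at V b e m j = w) \<and>
        (A \<in> C - set e \<and> vote_at V b e m A = w \<or>
         (\<exists>k\<le>m. e ! k = A \<and> vote_at V b e k A = w)))"

definition adds_candidate :: "'c \<Rightarrow> 'c list \<Rightarrow> 'c list \<Rightarrow> bool" where
  "adds_candidate A xs ys \<longleftrightarrow>
     A \<notin> set xs \<and> (\<exists>us vs. xs = us @ vs \<and> ys = us @ A # vs)"

definition moves_up :: "'c \<Rightarrow> 'c list \<Rightarrow> 'c list \<Rightarrow> bool" where
  "moves_up A xs ys \<longleftrightarrow>
     (\<exists>us vs ws. vs \<noteq> [] \<and> xs = us @ vs @ A # ws \<and> ys = us @ A # vs @ ws)"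

definition changed_in_favour ::
    "'c \<Rightarrow> 'v set \<Rightarrow> ('v \<Rightarrow> 'c list) \<Rightarrow> 'v set \<Rightarrow> ('v \<Rightarrow> 'c list) \<Rightarrow> bool" where
  "changed_in_favour A V b V' b' \<longleftrightarrow>
     V \<subseteq> V' \<and> finite V' \<and>
     (\<forall>v\<in>V' - V. b' v = [A]) \<and>
     (\<forall>v\<in>V. b' v = b v \<or> adds_candidate A (b v) (b' v) \<or> moves_up A (b v) (b' v))"

end

theory Submission
  imports Defs
begin

text \<open>
  Read \<open>1 / W\<close> as the time at which a candidate is elected; the place number of a ballot is then the
  latest election time among the candidates above its current top candidate. Let \<open>A\<close> be elected at
  time \<open>T\<close> in the old count, and suppose it is not elected in the new one. By induction, everybody
  elected before \<open>T\<close> in the new count is elected no later in the old one, since each ballot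
  counted for such a candidate is counted for it in the old count too and has spent no more there.
  Comparing the total power spent in both counts up to time \<open>T\<close> shows that \<open>A\<close> has available power
  at least \<open>1\<close> in the new count at time \<open>T\<close>. Hence all remaining seats of the new count are filled
  at time \<open>T\<close>, with \<open>A\<close> in the tie, and a winner of the new count who loses the old one must tie
  with \<open>A\<close> there.
\<close>

section \<open>Ballots: elected prefix, top candidate and the effect of a change\<close>

lemma find_not_mem_Some_iff:
  "find (\<lambda>j. j \<notin> E) xs = Some i \<longleftrightarrow>
     i \<notin> E \<and> (\<exists>ys. xs = takeWhile (\<lambda>j. j \<in> E) xs @ i # ys)"
  by (induction xs) auto

lemma takeWhile_insert_unchanged:
  assumes "find (\<lambda>j. j \<notin> E) xs \<noteq> Some c"
  shows "takeWhile (\<lambda>j. j \<in> insert c E) xs = takeWhile (\<lambda>j. j \<in> E) xs"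
  using assms by (induction xs) (auto split: if_splits)

lemma set_takeWhile_mono:
  assumes "E \<subseteq> F"
  shows "set (takeWhile (\<lambda>j. j \<in> E) xs) \<subseteq> set (takeWhile (\<lambda>j. j \<in> F) xs)"
  using assms by (induction xs) auto

lemma counted_for_disjoint:
  "i \<noteq> j \<Longrightarrow> counted_for V b E i \<inter> counted_for V b E j = {}"
  by (auto simp: counted_for_def)

lemma adds_candidate_prefix:
  assumes "adds_candidate A xs ys" "ys = us @ j # vs" "A \<notin> set us" "j \<noteq> A"
  shows "\<exists>ws. xs = us @ j # ws"
  using assms
  by (auto simp: adds_candidate_def append_eq_append_conv2 append_eq_Cons_conv Cons_eq_append_conv)

lemma moves_up_prefix:
  assumes "moves_up A xs ys" "ys = us @ j # vs" "A \<notin> set us" "j \<noteq> A"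
  shows "\<exists>ws. xs = us @ j # ws"
  using assms
  by (auto simp: moves_up_def append_eq_append_conv2 append_eq_Cons_conv Cons_eq_append_conv)

text \<open>On the new ballot \<open>A\<close> can only stand below the top candidate
  \<open>j\<close>, and a change leaves untouched what lies above the new place of \<open>A\<close>.
  Since \<open>j\<close> is outside \<open>E\<close>, the larger set \<open>E\<close> stops at
  \<open>j\<close> as well.\<close>

lemma ballot_agree:
  assumes change: "ys = xs \<or> adds_candidate A xs ys \<or> moves_up A xs ys"
    and "E' \<subseteq> E" "A \<notin> E'"
    and top: "\<And>j. find (\<lambda>j. j \<notin> E') ys = Some j \<Longrightarrow> j \<notin> E \<and> j \<noteq> A"
  shows "takeWhile (\<lambda>j. j \<in> E) xs = takeWhile (\<lambda>j. j \<in> E') ys"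
    and "find (\<lambda>j. j \<notin> E) xs = find (\<lambda>j. j \<notin> E') ys"
proof -
  have "takeWhile (\<lambda>j. j \<in> E) xs = takeWhile (\<lambda>j. j \<in> E') ys \<and>
    find (\<lambda>j. j \<notin> E) xs = find (\<lambda>j. j \<notin> E') ys"
  proof (cases "find (\<lambda>j. j \<notin> E') ys")
    case None
    then have ys: "set ys \<subseteq> E'"
      by (auto simp: find_None_iff)
    then have "A \<notin> set ys"
      using \<open>A \<notin> E'\<close> by auto
    \<comment> \<open>Both kinds of change leave \<open>A\<close> on the new ballot, so a ballot
      without \<open>A\<close> was not changed.\<close>
    then have "xs = ys"
      using change by (auto simp: adds_candidate_def moves_up_def)
    moreover have "takeWhile (\<lambda>j. j \<in> E) ys = ys" "takeWhile (\<lambda>j. j \<in> E') ys = ys"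
      using ys \<open>E' \<subseteq> E\<close> by (auto simp: subset_iff)
    moreover have "find (\<lambda>j. j \<notin> E) ys = None"
      using ys \<open>E' \<subseteq> E\<close> by (auto simp: find_None_iff)
    ultimately show ?thesis
      using None by metis
  next
    case (Some j)
    define us where "us = takeWhile (\<lambda>j. j \<in> E') ys"
    obtain vs where ys: "ys = us @ j # vs"
      using Some unfolding us_def by (auto simp: find_not_mem_Some_iff)
    have us: "set us \<subseteq> E'"
      unfolding us_def by (auto dest: set_takeWhileD)
    have j: "j \<notin> E" "j \<noteq> A"
      using top[OF Some] by auto
    have "A \<notin> set us"
      using us \<open>A \<notin> E'\<close> by auto
    then obtain ws where xs: "xs = us @ j # ws"
      using change ys j adds_candidate_prefix moves_up_prefix by metis
    have tw: "takeWhile (\<lambda>j. j \<in> E) xs = us"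
      using us j \<open>E' \<subseteq> E\<close> unfolding xs by (subst takeWhile_append2) auto
    moreover have "find (\<lambda>j. j \<notin> E) xs = Some j"
      using j xs tw by (auto simp: find_not_mem_Some_iff)
    ultimately show ?thesis
      using Some us_def by simp
  qed
  then show "takeWhile (\<lambda>j. j \<in> E) xs = takeWhile (\<lambda>j. j \<in> E') ys"
    and "find (\<lambda>j. j \<notin> E) xs = find (\<lambda>j. j \<notin> E') ys"
    by auto
qed

section \<open>A single count: election times and spent voting power\<close>

locale phragmen_count =
  fixes C :: "'c set" and V :: "'v set" and b :: "'v \<Rightarrow> 'c list" and s :: nat and e :: "'c list"
  assumes finV: "finite V"
    and result: "phragmen_result C V b s e"
begin

abbreviation elected :: "nat \<Rightarrow> 'c set" where
  "elected k \<equiv> set (take k e)"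

abbreviation B :: "nat \<Rightarrow> 'c \<Rightarrow> 'v set" where
  "B k \<equiv> counted_for V b (elected k)"

abbreviation r :: "nat \<Rightarrow> 'v \<Rightarrow> real" where
  "r \<equiv> place_number V b e"

abbreviation W :: "nat \<Rightarrow> real" where
  "W k \<equiv> vote_at V b e k (e ! k)"

lemma length_e: "length e = s"
  and nth_in: "k < s \<Longrightarrow> e ! k \<in> C"
  and nth_notin: "k < s \<Longrightarrow> e ! k \<notin> elected k"
  and vote_le_W: "k < s \<Longrightarrow> j \<in> C \<Longrightarrow> j \<notin> elected k \<Longrightarrow> vote_at V b e k j \<le> W k"
  using result by (auto simp: phragmen_result_def)

lemma elected_iff: "k \<le> s \<Longrightarrow> j \<in> elected k \<longleftrightarrow> (\<exists>q<k. e ! q = j)"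
  by (auto simp: in_set_conv_nth length_e)

lemma elected_Suc: "k < s \<Longrightarrow> elected (Suc k) = insert (e ! k) (elected k)"
  by (simp add: take_Suc_conv_app_nth length_e)

lemma takeWhile_elected_Suc:
  assumes "k < s" "find (\<lambda>j. j \<notin> elected k) xs \<noteq> Some (e ! k)"
  shows "takeWhile (\<lambda>j. j \<in> elected (Suc k)) xs = takeWhile (\<lambda>j. j \<in> elected k) xs"
  using takeWhile_insert_unchanged[OF assms(2)] assms(1) by (simp add: elected_Suc)

lemma nth_inj: "p < s \<Longrightarrow> q < s \<Longrightarrow> e ! p = e ! q \<Longrightarrow> p = q"
  by (metis elected_iff less_imp_le linorder_neqE_nat nth_notin)

lemma distinct_e: "distinct e"
  using nth_inj by (auto simp: distinct_conv_nth length_e)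

lemma card_elected: "k \<le> s \<Longrightarrow> card (elected k) = k"
  by (simp add: distinct_card distinct_e length_e)

lemma finite_B [simp]: "finite (B k j)"
  using finV by (simp add: counted_for_def)

lemma r_nonneg: "0 \<le> r k v"
proof (induction k arbitrary: v)
  case (Suc k)
  then show ?case
    by (auto simp: reduced_vote_def intro!: divide_nonneg_nonneg add_nonneg_nonneg sum_nonneg)
qed simp

lemma denominator_pos: "0 < 1 + (\<Sum>v\<in>B k j. r k v)"
  by (intro add_pos_nonneg sum_nonneg r_nonneg) simp

lemma vote_nonneg: "0 \<le> vote_at V b e k j"
  using denominator_pos[of k j] by (simp add: vote_at_def reduced_vote_def)

text \<open>At time \<open>1 / w\<close> a ballot has \<open>1 / w - r k v\<close> left, so the sum
  is \<open>w\<close> times the power available to \<open>j\<close>, compared with \<open>w\<close>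
  times 1. Cleared of division, the condition is linear in the place numbers and also covers
  \<open>w = 0\<close>.\<close>

lemma le_vote_iff:
  "w \<le> vote_at V b e k j \<longleftrightarrow> w \<le> (\<Sum>v\<in>B k j. 1 - w * r k v)"
  using denominator_pos[of k j]
  by (simp add: vote_at_def reduced_vote_def pos_le_divide_eq sum_subtractf
      sum_distrib_left algebra_simps)

lemma vote_le_iff:
  "vote_at V b e k j \<le> w \<longleftrightarrow> (\<Sum>v\<in>B k j. 1 - w * r k v) \<le> w"
  using denominator_pos[of k j]
  by (simp add: vote_at_def reduced_vote_def pos_divide_le_eq sum_subtractf
      sum_distrib_left algebra_simps)

lemma W_pos: "v \<in> B k (e ! k) \<Longrightarrow> 0 < W k"
  using denominator_pos[of k "e ! k"]
  by (auto simp: vote_at_def reduced_vote_def card_gt_0_iff intro!: divide_pos_pos)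

lemma r_Suc: "r (Suc k) v = (if v \<in> B k (e ! k) then 1 / W k else r k v)"
  by (simp add: vote_at_def)

text \<open>The ballots that a candidate inherits at seat \<open>k\<close> have place number \<open>1 / W k\<close>, so each of
  them contributes \<open>0\<close> to this sum.\<close>

lemma surplus_Suc:
  assumes k: "k < s" and j: "j \<notin> elected (Suc k)"
  shows "(\<Sum>v\<in>B (Suc k) j. 1 - W k * r (Suc k) v) = (\<Sum>v\<in>B k j. 1 - W k * r k v)"
proof -
  have j': "j \<notin> elected k" "j \<noteq> e ! k"
    using j k by (auto simp: elected_Suc)
  have notk: "v \<notin> B k (e ! k)" if "v \<in> B k j" for v
    using that j' by (auto simp: counted_for_def)
  have sub: "B k j \<subseteq> B (Suc k) j"
  proof
    fix v assume v: "v \<in> B k j"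
    then have "find (\<lambda>j. j \<notin> elected k) (b v) = Some j" "v \<in> V"
      by (auto simp: counted_for_def)
    moreover from this have
      "takeWhile (\<lambda>j. j \<in> elected (Suc k)) (b v) = takeWhile (\<lambda>j. j \<in> elected k) (b v)"
      using j' k by (intro takeWhile_elected_Suc) auto
    ultimately show "v \<in> B (Suc k) j"
      using j by (auto simp: counted_for_def find_not_mem_Some_iff)
  qed
  have new: "v \<in> B k (e ! k)" if "v \<in> B (Suc k) j" "v \<notin> B k j" for v
  proof (rule ccontr)
    assume "v \<notin> B k (e ! k)"
    then have "takeWhile (\<lambda>j. j \<in> elected (Suc k)) (b v) = takeWhile (\<lambda>j. j \<in> elected k) (b v)"
      using k that(1) by (intro takeWhile_elected_Suc) (auto simp: counted_for_def)
    then have "v \<in> B k j"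
      using that(1) j' by (auto simp: counted_for_def find_not_mem_Some_iff)
    then show False
      using that(2) by simp
  qed
  have "(\<Sum>v\<in>B (Suc k) j. 1 - W k * r (Suc k) v) = (\<Sum>v\<in>B k j. 1 - W k * r (Suc k) v)"
  proof (rule sum.mono_neutral_right)
    show "\<forall>v\<in>B (Suc k) j - B k j. 1 - W k * r (Suc k) v = 0"
    proof
      fix v assume "v \<in> B (Suc k) j - B k j"
      then have "v \<in> B k (e ! k)"
        using new by auto
      then show "1 - W k * r (Suc k) v = 0"
        using W_pos[of v k] by (subst r_Suc) simp
    qed
  qed (use sub in auto)
  also have "\<dots> = (\<Sum>v\<in>B k j. 1 - W k * r k v)"
    using notk by (intro sum.cong refl) (subst r_Suc, simp)
  finally show ?thesis .
qed

text \<open>Both sides are the same surplus condition. This carries a tie with the winner from one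
  seat to the next, and back.\<close>

lemma W_le_vote_Suc_iff:
  "k < s \<Longrightarrow> j \<notin> elected (Suc k) \<Longrightarrow>
     W k \<le> vote_at V b e (Suc k) j \<longleftrightarrow> W k \<le> vote_at V b e k j"
  unfolding le_vote_iff by (subst surplus_Suc) auto

lemma vote_Suc_le_W:
  assumes "k < s" "j \<in> C" "j \<notin> elected (Suc k)"
  shows "vote_at V b e (Suc k) j \<le> W k"
proof -
  have "vote_at V b e k j \<le> W k"
    using assms by (intro vote_le_W) (auto simp: elected_Suc)
  then show ?thesis
    unfolding vote_le_iff using assms by (subst surplus_Suc) auto
qed

lemma W_antimono:
  assumes "p \<le> q" "q < s"
  shows "W q \<le> W p"
  using assms
proof (induction q rule: dec_induct)
  case (step n)
  have "W (Suc n) \<le> W n"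
    using step.prems by (intro vote_Suc_le_W nth_in nth_notin) auto
  then show ?case
    using step by auto
qed simp

text \<open>A place number changes only when the top candidate is elected, who then joins the
  elected prefix. Together with \<open>inverse_W_le_r\<close> this makes the place number of a
  ballot in \<open>V\<close> the latest election time in that prefix.\<close>

lemma r_cases:
  assumes "k \<le> s"
  shows "r k v = 0 \<or>
    (\<exists>q<k. e ! q \<in> set (takeWhile (\<lambda>j. j \<in> elected k) (b v)) \<and> 0 < W q \<and> r k v = 1 / W q)"
  using assms
proof (induction k)
  case (Suc k)
  show ?case
  proof (cases "v \<in> B k (e ! k)")
    case True
    then obtain ys where ys: "b v = takeWhile (\<lambda>j. j \<in> elected k) (b v) @ (e ! k) # ys"
      by (auto simp: counted_for_def find_not_mem_Some_iff)
    have "e ! k \<in> set (takeWhile (\<lambda>j. j \<in> elected (Suc k)) (b v))"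
      using Suc.prems
      by (subst ys, subst takeWhile_append2) (auto simp: elected_Suc dest: set_takeWhileD)
    then show ?thesis
      using True W_pos[OF True] by (subst (1 2) r_Suc) auto
  next
    case False
    have "elected k \<subseteq> elected (Suc k)"
      using Suc.prems by (auto simp: elected_Suc)
    from set_takeWhile_mono[OF this, of "b v"] show ?thesis
      using False Suc by (subst (1 2) r_Suc) (auto intro: less_SucI)
  qed
qed simp

text \<open>Possibly \<open>e ! q\<close> was elected through other ballots while \<open>v\<close>
  counted for someone higher up. It then enters the prefix only once that candidate is elected,
  which happens later and hence with a vote of at most \<open>W q\<close>.\<close>

lemma inverse_W_le_r:
  assumes "k \<le> s" "v \<in> V" "q < k"
    and "e ! q \<in> set (takeWhile (\<lambda>j. j \<in> elected k) (b v))"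
  shows "1 / W q \<le> r k v"
  using assms
proof (induction k)
  case (Suc k)
  show ?case
  proof (cases "v \<in> B k (e ! k)")
    case True
    have "W k \<le> W q"
      using Suc.prems by (intro W_antimono) auto
    then show ?thesis
      using True W_pos[OF True] by (subst r_Suc) (simp add: frac_le)
  next
    case False
    have eq: "takeWhile (\<lambda>j. j \<in> elected (Suc k)) (b v) = takeWhile (\<lambda>j. j \<in> elected k) (b v)"
      using False Suc.prems
      by (intro takeWhile_elected_Suc) (auto simp: counted_for_def)
    with Suc.prems have mem: "e ! q \<in> set (takeWhile (\<lambda>j. j \<in> elected k) (b v))"
      by simp
    then have "e ! q \<in> elected k"
      by (auto dest: set_takeWhileD)
    then have "q < k"
      using Suc.prems nth_notin[of k] by (metis Suc_le_lessD less_antisym)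
    then show ?thesis
      using Suc.IH Suc.prems mem False by (subst r_Suc) simp
  qed
qed simp

text \<open>Place numbers so far are 0 or election times up to \<open>1 / w\<close>. No ballot is
  overspent at time \<open>1 / w\<close>, so enlarging a set of ballots cannot lower its
  surplus.\<close>

lemma weighted_r_le_1:
  assumes "k \<le> s" "0 < w" "\<And>q. q < k \<Longrightarrow> w \<le> W q"
  shows "w * r k v \<le> 1"
  using r_cases[OF assms(1), of v] assms by (auto simp: divide_le_eq_1)

text \<open>Each winner uses up exactly 1: afterwards its ballots have place numbers adding up to
  their number divided by \<open>W k\<close>, which is 1 more than before by the formula for the
  reduced vote. A winner without ballots would use nothing; positivity excludes it.\<close>

lemma sum_r:
  assumes "k \<le> s" "\<And>q. q < k \<Longrightarrow> 0 < W q"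
  shows "(\<Sum>v\<in>V. r k v) = k"
  using assms
proof (induction k)
  case (Suc k)
  let ?B = "B k (e ! k)"
  have sub: "?B \<subseteq> V"
    by (auto simp: counted_for_def)
  have "(\<Sum>v\<in>V. r (Suc k) v) = (\<Sum>v\<in>V - ?B. r (Suc k) v) + (\<Sum>v\<in>?B. r (Suc k) v)"
    by (rule sum.subset_diff[OF sub finV])
  also have "(\<Sum>v\<in>?B. r (Suc k) v) = card ?B / W k"
    by (simp add: vote_at_def)
  also have "\<dots> = 1 + (\<Sum>v\<in>?B. r k v)"
    using Suc.prems(2)[of k] denominator_pos[of k "e ! k"]
    by (auto simp: vote_at_def reduced_vote_def)
  also have "(\<Sum>v\<in>V - ?B. r (Suc k) v) = (\<Sum>v\<in>V - ?B. r k v)"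
    by (intro sum.cong) auto
  finally show ?case
    using Suc sum.subset_diff[OF sub finV, of "r k"] by simp
qed simp

end

section \<open>Comparison of the old and the new count\<close>

locale changed_count =
  old: phragmen_count C V b s e + new: phragmen_count C V' b' s e'
  for C :: "'c set" and V V' :: "'v set" and b b' :: "'v \<Rightarrow> 'c list" and s :: nat
    and e e' :: "'c list" +
  fixes A :: 'c
  assumes change: "changed_in_favour A V b V' b'"
begin

lemma V_subset: "V \<subseteq> V'"
  and ballot_new: "v \<in> V' - V \<Longrightarrow> b' v = [A]"
  and ballot_change: "v \<in> V \<Longrightarrow> b' v = b v \<or> adds_candidate A (b v) (b' v) \<or> moves_up A (b v) (b' v)"
  using change by (auto simp: changed_in_favour_def)

text \<open>A larger \<open>W\<close> is an earlier election, so this says "no later in the old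
  count". The two lengths are separate because the counts reach a given time after different numbers
  of seats.\<close>

definition dominated :: "nat \<Rightarrow> nat \<Rightarrow> bool" where
  "dominated l p \<longleftrightarrow> (\<forall>q'<l. \<exists>q<p. e ! q = e' ! q' \<and> new.W q' \<le> old.W q)"

lemma dominated_elected:
  "dominated l p \<Longrightarrow> l \<le> s \<Longrightarrow> p \<le> s \<Longrightarrow> new.elected l \<subseteq> old.elected p"
  unfolding dominated_def by (metis new.elected_iff old.elected_iff subsetI)

text \<open>The old place number is the election time of somebody in the common prefix. That
  candidate was elected no earlier in the new count, where the place number is at least its election
  time.\<close>

lemma r_le_r:
  assumes l: "l \<le> s" and p: "p \<le> s" and dom: "dominated l p" and v: "v \<in> V"
    and pos: "\<And>q'. q' < l \<Longrightarrow> 0 < new.W q'"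
    and pre: "takeWhile (\<lambda>j. j \<in> old.elected p) (b v) = takeWhile (\<lambda>j. j \<in> new.elected l) (b' v)"
  shows "old.r p v \<le> new.r l v"
  using old.r_cases[OF p, of v]
proof
  assume "old.r p v = 0"
  then show ?thesis
    using new.r_nonneg by simp
next
  assume "\<exists>q<p. e ! q \<in> set (takeWhile (\<lambda>j. j \<in> old.elected p) (b v)) \<and>
    0 < old.W q \<and> old.r p v = 1 / old.W q"
  then obtain q where q: "q < p" "e ! q \<in> set (takeWhile (\<lambda>j. j \<in> new.elected l) (b' v))"
    "0 < old.W q" "old.r p v = 1 / old.W q"
    using pre by auto
  then have "e ! q \<in> new.elected l"
    by (auto dest: set_takeWhileD)
  then obtain q' where q': "q' < l" "e' ! q' = e ! q"
    using new.elected_iff l by blast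
  then obtain q2 where q2: "q2 < p" "e ! q2 = e ! q" "new.W q' \<le> old.W q2"
    using dom unfolding dominated_def by metis
  then have "q2 = q"
    using q p old.nth_inj by force
  then have "1 / old.W q \<le> 1 / new.W q'"
    using q2 pos[OF q'(1)] by (simp add: frac_le)
  also have "\<dots> \<le> new.r l v"
    using l v V_subset q q' by (intro new.inverse_W_le_r) auto
  finally show ?thesis
    using q by simp
qed

text \<open>Every new ballot counted for \<open>e' ! l\<close> is counted for it in the old count
  too, having spent no more; further old ballots have nonnegative surplus at level \<open>w\<close>.
  The level is free so that both \<open>new.W l\<close> and the level at which \<open>A\<close> was
  elected can be used.\<close>

lemma vote_transfer:
  assumes l: "l < s" and p: "p \<le> s" and dom: "dominated l p"
    and w: "0 \<le> w" "w \<le> new.W l" "\<And>q. q < p \<Longrightarrow> w \<le> old.W q"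
    and A: "A \<notin> set e'" and j: "e' ! l \<notin> old.elected p"
  shows "w \<le> vote_at V b e p (e' ! l)"
proof (cases "w = 0")
  case True
  then show ?thesis
    using old.vote_nonneg by simp
next
  case False
  then have wpos: "0 < w"
    using w by simp
  let ?j = "e' ! l"
  have jA: "?j \<noteq> A"
    using A l new.length_e nth_mem by blast
  have A': "A \<notin> new.elected l"
    using A by (auto dest: in_set_takeD)
  have pos: "0 < new.W q'" if "q' < l" for q'
    using new.W_antimono[of q' l] that l w wpos by simp
  have sub: "v \<in> old.B p ?j \<and> old.r p v \<le> new.r l v" if v: "v \<in> new.B l ?j" for v
  proof -
    have f: "find (\<lambda>j. j \<notin> new.elected l) (b' v) = Some ?j" "v \<in> V'"
      using v by (auto simp: counted_for_def)
    \<comment> \<open>An added ballot \<open>[A]\<close> cannot have a top candidate other than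
      \<open>A\<close>.\<close>
    have vV: "v \<in> V"
      using f jA ballot_new[of v] by (cases "v \<in> V") (auto split: if_splits)
    note agree = ballot_agree[OF ballot_change[OF vV]
        dominated_elected[OF dom less_imp_le[OF l] p] A']
    have "takeWhile (\<lambda>j. j \<in> old.elected p) (b v) = takeWhile (\<lambda>j. j \<in> new.elected l) (b' v)"
      "find (\<lambda>j. j \<notin> old.elected p) (b v) = find (\<lambda>j. j \<notin> new.elected l) (b' v)"
      by (rule agree; use f j jA in simp)+
    then show ?thesis
      using f vV r_le_r[OF less_imp_le[OF l] p dom vV pos] by (auto simp: counted_for_def)
  qed
  have "w \<le> (\<Sum>v\<in>new.B l ?j. 1 - w * new.r l v)"
    using w(2) new.le_vote_iff by blast
  also have "\<dots> \<le> (\<Sum>v\<in>new.B l ?j. 1 - w * old.r p v)"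
    using sub wpos by (intro sum_mono) auto
  also have "\<dots> \<le> (\<Sum>v\<in>old.B p ?j. 1 - w * old.r p v)"
    using sub old.weighted_r_le_1[OF p wpos w(3)] by (intro sum_mono2) auto
  finally show ?thesis
    using old.le_vote_iff by blast
qed

text \<open>Conservation of voting power: the \<open>k + 1\<close> winners of the old count have used up exactly
  \<open>k + 1\<close>, and every ballot either has spent at least as much in the new count, or all its
  remaining power is available to one of those winners not yet elected there. So they have
  available at least their number on average.\<close>

lemma vote_A_ge:
  assumes k: "k < s" "e ! k = A" and m: "m < s" and dom: "dominated m k"
    and above: "\<And>l. l < m \<Longrightarrow> old.W k < new.W l" and le: "new.W m \<le> old.W k"
    and A: "A \<notin> set e'"
  shows "old.W k \<le> vote_at V' b' e' m A"
proof (cases "old.W k = 0")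
  case True
  then show ?thesis
    using new.vote_nonneg by simp
next
  case False
  define w where "w = old.W k"
  have wpos: "0 < w"
    using False old.vote_nonneg[of k "e ! k"] by (simp add: w_def)
  let ?E = "old.elected (Suc k)" and ?E' = "new.elected m"
  \<comment> \<open>The old winners up to and including \<open>A\<close> that are still without a
    seat in the new count.\<close>
  define D where "D = ?E - ?E'"
  have ks: "Suc k \<le> s"
    using k by simp
  have A': "A \<notin> ?E'"
    using A by (auto dest: in_set_takeD)
  have AD: "A \<in> D"
    using A' k by (auto simp: D_def old.elected_Suc)
  have dom': "dominated m (Suc k)"
    using dom unfolding dominated_def by (meson less_SucI)
  have sub: "?E' \<subseteq> ?E"
    using dominated_elected[OF dom'] ks m by simp
  have "m \<le> Suc k"
    using card_mono[OF _ sub] m ks by (simp add: new.card_elected old.card_elected)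
  then have cardD: "real (card D) = real (Suc k) - real m"
    unfolding D_def using sub m ks
    by (simp add: card_Diff_subset new.card_elected old.card_elected)
  have oldW: "w \<le> old.W q" if "q < Suc k" for q
    using that k old.W_antimono[of q k] unfolding w_def by simp
  have newW: "0 < new.W q" if "q < m" for q
    using above[OF that] wpos unfolding w_def by simp
  define X where "X = (\<Union>j\<in>D. new.B m j)"
  have XV: "X \<subseteq> V'"
    by (auto simp: X_def counted_for_def)
  have finX: "finite X"
    using XV new.finV finite_subset by blast
  \<comment> \<open>The new top candidate of such a ballot, if any, is neither in \<open>D\<close>
    nor in \<open>?E'\<close>, hence outside \<open>?E\<close>; so both elected prefixes
    agree.\<close>
  have spent: "w * old.r (Suc k) v \<le> w * new.r m v" if "v \<in> V" "v \<notin> X" for v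
  proof -
    have "j \<notin> ?E \<and> j \<noteq> A" if f: "find (\<lambda>j. j \<notin> ?E') (b' v) = Some j" for j
    proof -
      have "v \<in> new.B m j"
        using f \<open>v \<in> V\<close> V_subset by (auto simp: counted_for_def)
      then have "j \<notin> D"
        using \<open>v \<notin> X\<close> by (auto simp: X_def)
      moreover have "j \<notin> ?E'"
        using f by (simp add: find_not_mem_Some_iff)
      ultimately show ?thesis
        using AD by (auto simp: D_def)
    qed
    then have "takeWhile (\<lambda>j. j \<in> ?E) (b v) = takeWhile (\<lambda>j. j \<in> ?E') (b' v)"
      by (intro ballot_agree(1)[OF ballot_change[OF \<open>v \<in> V\<close>] sub A'])
    then show ?thesis
      using r_le_r[OF less_imp_le[OF m] ks dom' \<open>v \<in> V\<close> newW] wpos by simp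
  qed
  have sum_D: "(\<Sum>v\<in>X. 1 - w * new.r m v) = (\<Sum>j\<in>D. \<Sum>v\<in>new.B m j. 1 - w * new.r m v)"
    unfolding X_def by (rule sum.UNION_disjoint) (auto simp: D_def counted_for_disjoint)
  have "w * real (Suc k) = (\<Sum>v\<in>V. w * old.r (Suc k) v)"
    using old.sum_r[OF ks] oldW wpos by (simp add: sum_distrib_left[symmetric] less_le_trans del: place_number.simps)
  \<comment> \<open>On \<open>X\<close> the summand on the right is 1, which bounds the old
    spending; off \<open>X\<close> it is the bound from \<open>spent\<close>.\<close>
  also have "\<dots> \<le> (\<Sum>v\<in>V. w * new.r m v + (if v \<in> X then 1 - w * new.r m v else 0))"
    using spent old.weighted_r_le_1[OF ks wpos oldW]
    by (intro sum_mono) (auto simp del: place_number.simps)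
  also have "\<dots> \<le> (\<Sum>v\<in>V'. w * new.r m v + (if v \<in> X then 1 - w * new.r m v else 0))"
    using new.finV V_subset wpos new.r_nonneg by (intro sum_mono2) auto
  also have "\<dots> = w * (\<Sum>v\<in>V'. new.r m v) + (\<Sum>v\<in>X. 1 - w * new.r m v)"
    using XV new.finV by (simp add: sum.distrib sum_distrib_left sum.inter_restrict[symmetric] Int_absorb1)
  also have "(\<Sum>v\<in>V'. new.r m v) = real m"
    using new.sum_r[of m] m newW by simp
  finally have total: "w * real (card D) \<le> (\<Sum>j\<in>D. \<Sum>v\<in>new.B m j. 1 - w * new.r m v)"
    unfolding sum_D cardD by (simp add: algebra_simps)
  \<comment> \<open>Nobody in \<open>D\<close> exceeds \<open>w\<close> at seat \<open>m\<close>,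
    while by \<open>total\<close> the average over \<open>D\<close> is at least \<open>w\<close>; so
    no share, in particular that of \<open>A\<close>, can fall below \<open>w\<close>.\<close>
  have each: "(\<Sum>v\<in>new.B m j. 1 - w * new.r m v) \<le> w" if "j \<in> D" for j
  proof -
    have "j \<in> C" "j \<notin> ?E'"
      using that old.elected_iff[OF ks] old.nth_in ks by (auto simp: D_def)
    then have "vote_at V' b' e' m j \<le> w"
      using new.vote_le_W[OF m] le unfolding w_def by force
    then show ?thesis
      by (simp add: new.vote_le_iff)
  qed
  have "w \<le> (\<Sum>v\<in>new.B m A. 1 - w * new.r m v)"
  proof (rule ccontr)
    assume "\<not> ?thesis"
    then have "(\<Sum>j\<in>D. \<Sum>v\<in>new.B m j. 1 - w * new.r m v) < (\<Sum>j\<in>D. w)"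
      using each AD by (intro sum_strict_mono_ex1) (auto simp: D_def not_le)
    then show False
      using total by (simp add: mult.commute)
  qed
  then show ?thesis
    by (simp add: new.le_vote_iff w_def)
qed

section \<open>When \<open>A\<close> loses its seat: ties at the level of \<open>A\<close> in both
  counts\<close>

context
  fixes k :: nat
  assumes k: "k < s" "e ! k = A" and A: "A \<notin> set e'"
begin

lemma winner_above:
  "l < s \<Longrightarrow> old.W k < new.W l \<Longrightarrow> \<exists>q<k. e ! q = e' ! l \<and> new.W l \<le> old.W q"
proof (induction l rule: less_induct)
  case (less l)
  show ?case
  proof (rule ccontr)
    assume contr: "\<not> ?case"
    \<comment> \<open>The first old seat filled later than \<open>e' ! l\<close> is elected in the
      new count; seat \<open>k\<close> is such a seat. If \<open>e' ! l\<close> is still free there,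
      the transferred vote makes it beat the old winner of seat \<open>p\<close>.\<close>
    define p where "p = (LEAST p. old.W p < new.W l)"
    have p: "old.W p < new.W l" "p \<le> k"
      unfolding p_def using less.prems by (auto intro: LeastI Least_le)
    have before: "new.W l \<le> old.W q" if "q < p" for q
      using not_less_Least[of q "\<lambda>p. old.W p < new.W l"] that unfolding p_def by simp
    have "p < s" "p \<le> s"
      using p k by auto
    have dom: "dominated l p"
      unfolding dominated_def
    proof (intro allI impI)
      fix q' assume q': "q' < l"
      have W: "new.W l \<le> new.W q'"
        using q' less.prems by (intro new.W_antimono) auto
      then obtain q where q: "q < k" "e ! q = e' ! q'" "new.W q' \<le> old.W q"
        using less.IH[OF q'] q' less.prems by auto
      have "q < p"
      proof (rule ccontr)
        assume "\<not> q < p"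
        then have "old.W q \<le> old.W p"
          using q k by (intro old.W_antimono) auto
        then show False
          using p q W by simp
      qed
      then show "\<exists>q<p. e ! q = e' ! q' \<and> new.W q' \<le> old.W q"
        using q by auto
    qed
    \<comment> \<open>An old seat before \<open>p\<close> would be early enough to satisfy the
      claim.\<close>
    have notin: "e' ! l \<notin> old.elected p"
      using contr before p old.elected_iff[OF \<open>p \<le> s\<close>] by fastforce
    have "new.W l \<le> vote_at V b e p (e' ! l)"
      using less.prems before A notin new.vote_nonneg
      by (intro vote_transfer[OF _ \<open>p \<le> s\<close> dom]) auto
    also have "\<dots> \<le> old.W p"
      using notin less.prems by (intro old.vote_le_W \<open>p < s\<close> new.nth_in)
    finally show False
      using p by simp
  qed
qed

lemma vote_A_last:
  "vote_at V' b' e' (s - 1) A = old.W k" "new.W (s - 1) = old.W k"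
proof -
  have AC: "A \<in> C"
    using old.nth_in k by blast
  have notin: "A \<notin> new.elected l" for l
    using A by (auto dest: in_set_takeD)
  have "\<exists>m<s. new.W m \<le> old.W k"
  proof (rule ccontr)
    assume "\<not> ?thesis"
    then have "new.elected s \<subseteq> old.elected k"
      using winner_above k by (fastforce simp: new.elected_iff old.elected_iff not_le)
    then have "s \<le> k"
      using card_mono[of "old.elected k" "new.elected s"] k
      by (simp add: new.card_elected old.card_elected)
    then show False
      using k by simp
  qed
  then obtain m0 where m0: "m0 < s" "new.W m0 \<le> old.W k"
    by blast
  define m where "m = (LEAST m. new.W m \<le> old.W k)"
  have m: "new.W m \<le> old.W k" "m < s"
    unfolding m_def using LeastI[of "\<lambda>m. new.W m \<le> old.W k", OF m0(2)]
      Least_le[of "\<lambda>m. new.W m \<le> old.W k", OF m0(2)] m0(1) by auto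
  have above: "old.W k < new.W l" if "l < m" for l
    using not_less_Least[of l "\<lambda>m. new.W m \<le> old.W k"] that unfolding m_def by simp
  have "dominated m k"
    unfolding dominated_def using winner_above above m by simp
  then have start: "old.W k \<le> vote_at V' b' e' m A"
    using vote_A_ge k m above A by blast
  \<comment> \<open>From seat \<open>m\<close> on, the unelected \<open>A\<close> keeps every winner
    at level \<open>old.W k\<close> or above, while the votes of winners cannot rise again.\<close>
  have "old.W k \<le> vote_at V' b' e' l A \<and> new.W l = old.W k" if "m \<le> l" "l < s" for l
    using that
  proof (induction l rule: dec_induct)
    case base
    then show ?case
      using start m new.vote_le_W[OF _ AC notin, of m] by simp
  next
    case (step n)
    then have "old.W k \<le> vote_at V' b' e' (Suc n) A"
      using new.W_le_vote_Suc_iff[of n A] notin by simp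
    moreover have "new.W (Suc n) \<le> new.W n"
      using step.prems by (intro new.W_antimono) auto
    ultimately show ?case
      using step new.vote_le_W[OF _ AC notin, of "Suc n"] by simp
  qed
  from this[of "s - 1"] have "old.W k \<le> vote_at V' b' e' (s - 1) A" "new.W (s - 1) = old.W k"
    using m by auto
  moreover have "vote_at V' b' e' (s - 1) A \<le> new.W (s - 1)"
    using m by (intro new.vote_le_W AC notin) simp
  ultimately show "vote_at V' b' e' (s - 1) A = old.W k" "new.W (s - 1) = old.W k"
    by auto
qed

text \<open>Both counts fill \<open>s\<close> seats and \<open>A\<close> is missing from the new
  one, so some new winner is not among the first \<open>p\<close> old ones; its vote transfers. The
  case \<open>p = s\<close> yields a loser of the old count.\<close>

lemma tied_candidate:
  assumes p: "p \<le> s" and before: "\<And>q. q < p \<Longrightarrow> old.W k \<le> old.W q"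
  shows "\<exists>j\<in>C. j \<notin> old.elected p \<and> old.W k \<le> vote_at V b e p j"
proof -
  have "\<not> set e' \<subseteq> old.elected p"
  proof
    assume "set e' \<subseteq> old.elected p"
    then have "set e' \<subseteq> set e"
      using set_take_subset[of p e] by blast
    moreover have "card (set e') = card (set e)"
      by (simp add: distinct_card old.distinct_e new.distinct_e old.length_e new.length_e)
    ultimately have "set e' = set e"
      by (intro card_subset_eq) auto
    then show False
      using k A old.length_e nth_mem by blast
  qed
  then have "\<exists>l. l < s \<and> e' ! l \<notin> old.elected p"
    by (metis in_set_conv_nth new.length_e subsetI)
  \<comment> \<open>Taking the first such winner puts all earlier new winners among the first
    \<open>p\<close> old ones, as \<open>dominated\<close> requires.\<close>
  define l where "l = (LEAST l. l < s \<and> e' ! l \<notin> old.elected p)"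
  have l: "l < s" "e' ! l \<notin> old.elected p"
    using LeastI_ex[OF \<open>\<exists>l. _ l\<close>] unfolding l_def by auto
  have "dominated l p"
    unfolding dominated_def
  proof (intro allI impI)
    fix q' assume q': "q' < l"
    then have "e' ! q' \<in> old.elected p"
      using not_less_Least[of q' "\<lambda>l. l < s \<and> e' ! l \<notin> old.elected p"] l unfolding l_def by auto
    then obtain q where q: "q < p" "e ! q = e' ! q'"
      using old.elected_iff[OF p] by auto
    have "new.W q' \<le> old.W q"
    proof (cases "old.W k < new.W q'")
      case True
      then obtain q2 where q2: "q2 < k" "e ! q2 = e' ! q'" "new.W q' \<le> old.W q2"
        using winner_above[of q'] q' l by auto
      then have "q2 = q"
        using q p k by (intro old.nth_inj) auto
      then show ?thesis
        using q2 by simp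
    next
      case False
      then show ?thesis
        using before[OF q(1)] by simp
    qed
    then show "\<exists>q<p. e ! q = e' ! q' \<and> new.W q' \<le> old.W q"
      using q by auto
  qed
  moreover have "old.W k \<le> new.W l"
    using new.W_antimono[of l "s - 1"] vote_A_last l by simp
  ultimately have "old.W k \<le> vote_at V b e p (e' ! l)"
    using l p before A old.vote_nonneg by (intro vote_transfer) auto
  then show ?thesis
    using l new.nth_in by auto
qed

text \<open>Some candidate still free at seat \<open>q\<close> reaches this level. With
  \<open>old.W_antimono\<close>, all old seats from \<open>k\<close> on are therefore filled at the
  same level.\<close>

lemma old_W_ge:
  assumes "q < s"
  shows "old.W k \<le> old.W q"
  using assms
proof (induction q rule: less_induct)
  case (less q)
  then obtain j where "j \<in> C" "j \<notin> old.elected q" "old.W k \<le> vote_at V b e q j"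
    using tied_candidate[of q] by auto
  then show ?case
    using old.vote_le_W[OF less.prems] by force
qed

lemma ties:
  "ties_for_last_place C V b e A" "ties_for_last_place C V' b' e' A"
proof -
  have AC: "A \<in> C"
    using old.nth_in k by blast
  show "ties_for_last_place C V' b' e' A"
    using AC A vote_A_last by (auto simp: ties_for_last_place_def Let_def new.length_e)
  define m where "m = s - 1"
  have m: "m < s" "k \<le> m" "s = Suc m"
    using k by (auto simp: m_def)
  have Wm: "old.W m = old.W k"
    using old_W_ge[OF m(1)] old.W_antimono[OF m(2,1)] by simp
  obtain j where j: "j \<in> C" "j \<notin> old.elected s" "old.W k \<le> vote_at V b e s j"
    using tied_candidate[of s] old_W_ge by auto
  \<comment> \<open>The loser \<open>j\<close> was found with its vote after all \<open>s\<close>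
    seats; the tie is read off one step earlier, at the last seat.\<close>
  have "old.W m \<le> vote_at V b e m j"
    using old.W_le_vote_Suc_iff[of m j] j m Wm by simp
  moreover have "vote_at V b e m j \<le> old.W m"
    using j m by (intro old.vote_le_W) (auto simp: old.elected_Suc)
  moreover have "j \<notin> set e"
    using j(2) old.length_e by simp
  ultimately show "ties_for_last_place C V b e A"
    using j(1) k m Wm
    by (auto simp: ties_for_last_place_def Let_def old.length_e intro!: exI[of _ k] bexI[of _ j])
qed

end

end

theorem theorem14p3:
  fixes C :: "'c set" and V V' :: "'v set" and b b' :: "'v \<Rightarrow> 'c list"
    and A :: 'c and s :: nat and e e' :: "'c list"
  assumes "election C V b"
    and "A \<in> C"
    and "s \<ge> 1"
    and "changed_in_favour A V b V' b'"
    and "phragmen_result C V b s e"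
    and "phragmen_result C V' b' s e'"
    and same_tie_resolution:
      "ties_for_last_place C V b e A \<Longrightarrow> ties_for_last_place C V' b' e' A \<Longrightarrow>
         A \<in> set e \<longleftrightarrow> A \<in> set e'"
    and "A \<in> set e"
  shows "A \<in> set e'"
proof (rule ccontr)
  assume A: "A \<notin> set e'"
  interpret changed_count C V V' b b' s e e' A
    using assms by unfold_locales (auto simp: election_def changed_in_favour_def)
  obtain k where "k < s" "e ! k = A"
    using \<open>A \<in> set e\<close> by (auto simp: in_set_conv_nth old.length_e)
  then show False
    using ties A same_tie_resolution \<open>A \<in> set e\<close> by blast
qed

end
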